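(* If $J$ is a Jordan curve in $\mathbb{K}^2$ consisting only of pure points and $|J|>4$, then $\mathbb{K}^2\setminus J$ has exactly two connected components. Moreover, each point of $J$ is adjacent to both components of $\mathbb{K}^2\setminus J$.
   Context: $\mathbb{K}$ is $\mathbb{Z}$ with the Khalimsky topology, generated by the sets $N(n)=\{n\}$ for $n$ odd and $N(n)=\{n-1,n,n+1\}$ for $n$ even; $\mathbb{K}^2$ has the product topology. For $x\in\mathbb{K}^2$, $A(x)=\{y\neq x:\{x,y\}\text{ is connected}\}$; a point $x$ is adjacent to a set $S$ if $A(x)\cap S\neq\emptyset$. A point of $\mathbb{K}^2$ is pure if its coordinates are both even or both odd, and mixed otherwise. An arc in $\mathbb{K}^2$ is a subset which, with the subspace topology, is homeomorphic to a finite interval of $\mathbb{K}$. A Jordan curve in $\mathbb{K}^2$ is a connected subset $J$ with $|J|\ge 4$ such that $J\setminus\{x\}$ is an arc for every $x\in J$. *)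

theory Defs
  imports "HOL-Analysis.Analysis"
begin

definition khal_nbhd :: "int \<Rightarrow> int set" where
  "khal_nbhd n = (if odd n then {n} else {n - 1, n, n + 1})"

definition khalimsky :: "int topology" where
  "khalimsky = topology_generated_by (range khal_nbhd)"

definition khalimsky_plane :: "(int \<times> int) topology" where
  "khalimsky_plane = prod_topology khalimsky khalimsky"

definition adjacency_set :: "int \<times> int \<Rightarrow> (int \<times> int) set" where
  "adjacency_set x = {y. y \<noteq> x \<and> connectedin khalimsky_plane {x, y}}"

definition adjacent_to :: "int \<times> int \<Rightarrow> (int \<times> int) set \<Rightarrow> bool" where
  "adjacent_to x S \<longleftrightarrow> adjacency_set x \<inter> S \<noteq> {}"

definition pure_point :: "int \<times> int \<Rightarrow> bool" where
  "pure_point x \<longleftrightarrow> (even (fst x) \<and> even (snd x)) \<or> (odd (fst x) \<and> odd (snd x))"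

text \<open>The finite intervals of the integers are exactly the sets \<open>{a..b}\<close>; the empty one
  (\<open>b < a\<close>) is immaterial for Jordan curves, which have at least four points.\<close>

definition khal_arc :: "(int \<times> int) set \<Rightarrow> bool" where
  "khal_arc S \<longleftrightarrow>
     (\<exists>a b. subtopology khalimsky_plane S homeomorphic_space subtopology khalimsky {a..b})"

text \<open>Although \<open>card\<close> is \<open>0\<close> on infinite sets, no infinite curve is lost: deleting a point
  from \<open>J\<close> leaves an arc, and arcs are finite.\<close>

definition khal_jordan_curve :: "(int \<times> int) set \<Rightarrow> bool" where
  "khal_jordan_curve J \<longleftrightarrow>
     connectedin khalimsky_plane J \<and> card J \<ge> 4 \<and> (\<forall>x\<in>J. khal_arc (J - {x}))"

lemma topspace_khalimsky [simp]: "topspace khalimsky = UNIV"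
proof -
  have "n \<in> khal_nbhd n" for n
    by (simp add: khal_nbhd_def)
  then show ?thesis
    unfolding khalimsky_def topology_generated_by_topspace by blast
qed

lemma topspace_khalimsky_plane [simp]: "topspace khalimsky_plane = UNIV"
  by (simp add: khalimsky_plane_def)

end

theory Submission
  imports Defs
begin

text \<open>The pure points form a square lattice under diagonal adjacency, and the mixed points are
  its unit faces. A pure Jordan curve \<open>J\<close> with more than four points is a cycle of this lattice in
  which every point has exactly two neighbours. Counting modulo 2 the edges of \<open>J\<close> crossed by a
  diagonal ray gives a parity of faces that changes precisely across edges of \<open>J\<close>, hence is constant
  on components of the complement, so there are at least two. The four faces around a
  point of \<open>J\<close> fall into one connected group for each parity; following \<open>J\<close> along an edge, whose two
  sides have different parities, identifies the groups at neighbouring points. As every point of the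
  complement is joined to a face touching \<open>J\<close>, there are exactly two components, and each point
  of \<open>J\<close> touches both.\<close>

section \<open>Spaces with minimal neighbourhoods\<close>

text \<open>These are Alexandrov spaces: \<open>N p\<close> is the smallest open set containing
  \<open>p\<close>. Both the line and the plane are instances.\<close>

locale minimal_nbhds =
  fixes X :: "'a topology" and N :: "'a \<Rightarrow> 'a set"
  assumes topspace_UNIV: "topspace X = UNIV"
    and openin_iff: "openin X U \<longleftrightarrow> (\<forall>p\<in>U. N p \<subseteq> U)"
    and nbhd_refl: "p \<in> N p"
    and nbhd_trans: "q \<in> N p \<Longrightarrow> N q \<subseteq> N p"
begin

lemma connectedin_pair_iff: "connectedin X {p, q} \<longleftrightarrow> q \<in> N p \<or> p \<in> N q"
proof
  assume con: "connectedin X {p, q}"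
  show "q \<in> N p \<or> p \<in> N q"
  proof (rule ccontr)
    assume "\<not> (q \<in> N p \<or> p \<in> N q)"
    moreover have "openin X (N p)" "openin X (N q)"
      using nbhd_trans by (auto simp: openin_iff)
    ultimately show False
      using con nbhd_refl[of p] nbhd_refl[of q] unfolding connectedin by blast
  qed
next
  assume "q \<in> N p \<or> p \<in> N q"
  then show "connectedin X {p, q}"
    unfolding connectedin topspace_UNIV openin_iff by blast
qed

text \<open>Induction along adjacency. If \<open>P\<close> failed at \<open>q\<close>, the
  neighbourhoods of the points with \<open>P\<close> and of those without it would form two open
  sets covering \<open>S\<close>. A point of \<open>S\<close> in both would carry \<open>P\<close>
  from one kind to the other, so they would separate \<open>S\<close>.\<close>

lemma connectedin_closed_under_adjacency:
  assumes "connectedin X S" "p \<in> S" "P p"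
    and step: "\<And>x y. x \<in> S \<Longrightarrow> y \<in> S \<Longrightarrow> connectedin X {x, y} \<Longrightarrow> P x \<Longrightarrow> P y"
    and "q \<in> S"
  shows "P q"
proof (rule ccontr)
  assume "\<not> P q"
  let ?U = "\<Union>x\<in>{x\<in>S. P x}. N x" and ?V = "\<Union>x\<in>{x\<in>S. \<not> P x}. N x"
  have "openin X ?U" "openin X ?V"
    using nbhd_trans by (fastforce simp: openin_iff)+
  moreover have "S \<subseteq> ?U \<union> ?V" "p \<in> ?U" "q \<in> ?V"
    using nbhd_refl assms(2,3,5) \<open>\<not> P q\<close> by blast+
  moreover have "P y" if "x \<in> S" "y \<in> S" "P x" "y \<in> N x \<or> x \<in> N y" for x y
    using that step[of x y] connectedin_pair_iff by blast
  then have "?U \<inter> ?V \<inter> S = {}"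
    by blast
  ultimately show False
    using assms(1,2,5) unfolding connectedin by blast
qed

end

section \<open>Adjacency in the Khalimsky plane\<close>

lemma khal_nbhd_refl: "n \<in> khal_nbhd n"
  by (simp add: khal_nbhd_def)

lemma khal_nbhd_trans: "m \<in> khal_nbhd n \<Longrightarrow> khal_nbhd m \<subseteq> khal_nbhd n"
  by (auto simp: khal_nbhd_def split: if_splits)

lemma openin_khalimsky_iff: "openin khalimsky U \<longleftrightarrow> (\<forall>n\<in>U. khal_nbhd n \<subseteq> U)"
proof
  assume "openin khalimsky U"
  then have "generate_topology_on (range khal_nbhd) U"
    by (simp add: khalimsky_def openin_topology_generated_by_iff)
  then show "\<forall>n\<in>U. khal_nbhd n \<subseteq> U"
  proof induction
    case (Basis s)
    then show ?case
      using khal_nbhd_trans by blast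
  qed blast+
next
  assume *: "\<forall>n\<in>U. khal_nbhd n \<subseteq> U"
  have "openin khalimsky (\<Union>n\<in>U. khal_nbhd n)"
    unfolding khalimsky_def by (intro openin_Union) (auto intro: topology_generated_by_Basis)
  moreover have "(\<Union>n\<in>U. khal_nbhd n) = U"
    using * khal_nbhd_refl by blast
  ultimately show "openin khalimsky U"
    by simp
qed

interpretation khalimsky: minimal_nbhds khalimsky khal_nbhd
  by unfold_locales (use khal_nbhd_trans in \<open>auto simp: openin_khalimsky_iff khal_nbhd_refl\<close>)

lemma openin_khalimsky_plane_iff:
  "openin khalimsky_plane U \<longleftrightarrow> (\<forall>p\<in>U. khal_nbhd (fst p) \<times> khal_nbhd (snd p) \<subseteq> U)"
proof -
  have "(\<exists>V W. openin khalimsky V \<and> openin khalimsky W \<and> x \<in> V \<and> y \<in> W \<and> V \<times> W \<subseteq> U)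
    \<longleftrightarrow> khal_nbhd x \<times> khal_nbhd y \<subseteq> U" (is "?L \<longleftrightarrow> ?R") for x y
  proof
    assume ?L
    then show ?R
      unfolding openin_khalimsky_iff by blast
  next
    assume ?R
    then show ?L
      using khal_nbhd_refl khal_nbhd_trans
      by (intro exI[of _ "khal_nbhd x"] exI[of _ "khal_nbhd y"]) (simp add: openin_khalimsky_iff)
  qed
  then show ?thesis
    by (simp add: khalimsky_plane_def openin_prod_topology_alt Ball_def split_paired_All)
qed

interpretation khalimsky_plane:
  minimal_nbhds khalimsky_plane "\<lambda>p. khal_nbhd (fst p) \<times> khal_nbhd (snd p)"
proof
  show "khal_nbhd (fst q) \<times> khal_nbhd (snd q) \<subseteq> khal_nbhd (fst p) \<times> khal_nbhd (snd p)"
    if "q \<in> khal_nbhd (fst p) \<times> khal_nbhd (snd p)" for p q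
    using that by (intro Sigma_mono khal_nbhd_trans) (auto simp: mem_Times_iff)
qed (auto simp: openin_khalimsky_plane_iff khal_nbhd_refl mem_Times_iff)

lemma connectedin_khalimsky_pair_iff: "connectedin khalimsky {m, n} \<longleftrightarrow> \<bar>m - n\<bar> \<le> 1"
  unfolding khalimsky.connectedin_pair_iff khal_nbhd_def by (auto; presburger)

text \<open>A diagonal step changes both parities. One minimal neighbourhood then contains the other
  point only if one of the points has two even coordinates, which makes both points pure.\<close>

lemma connectedin_khalimsky_plane_pair_iff:
  "connectedin khalimsky_plane {(x, y), (x', y')} \<longleftrightarrow>
     \<bar>x - x'\<bar> + \<bar>y - y'\<bar> \<le> 1 \<or> \<bar>x - x'\<bar> = 1 \<and> \<bar>y - y'\<bar> = 1 \<and> pure_point (x, y)"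
proof -
  have *: "m \<in> khal_nbhd n \<longleftrightarrow> m = n \<or> even n \<and> \<bar>n - m\<bar> = 1" for m n
    by (auto simp: khal_nbhd_def)
  have par: "\<bar>m - n\<bar> = 1 \<Longrightarrow> even m \<longleftrightarrow> odd n" for m n :: int
    by presburger
  show ?thesis
    using par[of x x'] par[of y y']
    unfolding khalimsky_plane.connectedin_pair_iff pure_point_def fst_conv snd_conv mem_Times_iff *
    by (smt (verit, best))
qed

section \<open>Neighbours in arcs and Jordan curves\<close>

text \<open>Adjacency is a topological notion, so the homeomorphism turns it into distance one in an
  integer interval. An interval with at least two members contains one or both of the integers next
  to a given member.\<close>

lemma khal_arc_neighbours:
  assumes "khal_arc S" "card S \<ge> 2" "v \<in> S"
  shows "S \<inter> adjacency_set v \<noteq> {}" and "card (S \<inter> adjacency_set v) \<le> 2"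
proof -
  obtain a b f where f: "homeomorphic_map (subtopology khalimsky_plane S) (subtopology khalimsky {a..b}) f"
    using assms(1) unfolding khal_arc_def homeomorphic_space by blast
  have bij: "bij_betw f S {a..b}"
    using homeomorphic_imp_injective_map[OF f] homeomorphic_imp_surjective_map[OF f]
    by (simp add: bij_betw_def)
  have adj: "w \<in> adjacency_set v \<longleftrightarrow> \<bar>f v - f w\<bar> = 1" if "w \<in> S" for w
  proof -
    have "connectedin (subtopology khalimsky_plane S) {v, w} \<longleftrightarrow>
        connectedin (subtopology khalimsky {a..b}) {f v, f w}"
      using homeomorphic_map_connectedness_eq[OF f, of "{v, w}"] that assms(3) by simp
    moreover have "f v \<in> {a..b}" "f w \<in> {a..b}"
      using bij that assms(3) by (meson bij_betwE)+
    moreover have "f v = f w \<longleftrightarrow> v = w"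
      using bij that assms(3) by (metis bij_betw_imp_inj_on inj_on_eq_iff)
    ultimately show ?thesis
      using that assms(3)
      by (auto simp: adjacency_set_def connectedin_subtopology connectedin_khalimsky_pair_iff)
  qed
  have img: "f ` (S \<inter> adjacency_set v) = {f v - 1, f v + 1} \<inter> {a..b}"
  proof -
    have "f ` (S \<inter> adjacency_set v) = {n \<in> f ` S. \<bar>f v - n\<bar> = 1}"
      using adj by blast
    also have "\<dots> = {f v - 1, f v + 1} \<inter> {a..b}"
      using bij by (auto simp: bij_betw_def)
    finally show ?thesis .
  qed
  have "f v \<in> {a..b}" "card {a..b} \<ge> 2"
    using bij assms(2,3) bij_betw_same_card[OF bij] by (auto dest: bij_betwE)
  then have "{f v - 1, f v + 1} \<inter> {a..b} \<noteq> {}"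
    by auto
  with img show "S \<inter> adjacency_set v \<noteq> {}"
    by auto
  have "inj_on f (S \<inter> adjacency_set v)"
    using bij by (auto simp: bij_betw_def intro: inj_on_subset)
  then have "card (S \<inter> adjacency_set v) = card ({f v - 1, f v + 1} \<inter> {a..b})"
    using img by (metis card_image)
  also have "\<dots> \<le> card {f v - 1, f v + 1}"
    by (intro card_mono) auto
  finally show "card (S \<inter> adjacency_set v) \<le> 2"
    by simp
qed

text \<open>Deleting a point other than \<open>v\<close> leaves an arc, in which \<open>v\<close>
  has one or two neighbours. Deleting a neighbour of \<open>v\<close> thus bounds the number in
  \<open>J\<close> between two and three; deleting a non-neighbour lowers the upper bound to
  two.\<close>

lemma khal_jordan_curve_degree:
  assumes "khal_jordan_curve J" "card J > 4" "v \<in> J"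
  shows "card (J \<inter> adjacency_set v) = 2"
proof -
  let ?A = "J \<inter> adjacency_set v"
  have fin: "finite J"
    using assms(2) by (intro card_ge_0_finite) simp
  have nb: "(J - {x}) \<inter> adjacency_set v \<noteq> {}" "card ((J - {x}) \<inter> adjacency_set v) \<le> 2"
    if "x \<in> J" "x \<noteq> v" for x
    using khal_arc_neighbours[of "J - {x}" v] assms that fin
    by (auto simp: khal_jordan_curve_def)
  have minus: "(J - {x}) \<inter> adjacency_set v = ?A - {x}" for x
    by blast
  have "v \<notin> ?A"
    by (simp add: adjacency_set_def)
  obtain z where "z \<in> J" "z \<noteq> v"
    using assms(2,3) by (metis card_1_singleton_iff is_singletonI' is_singleton_altdef
        less_irrefl_nat one_less_numeral_iff order.strict_trans semiring_norm(76) empty_iff)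
  then obtain w where w: "w \<in> ?A"
    using nb(1) by blast
  with nb(1)[of w] \<open>v \<notin> ?A\<close> obtain w' where "w' \<in> ?A" "w' \<noteq> w"
    unfolding minus by blast
  then have "card {w, w'} \<le> card ?A"
    using w fin by (intro card_mono) auto
  then have ge: "card ?A \<ge> 2"
    using \<open>w' \<noteq> w\<close> by simp
  have le3: "card ?A \<le> 3"
    using nb(2)[of w] w \<open>v \<notin> ?A\<close> unfolding minus by (cases "w = v") (auto simp: card_Diff_singleton)
  \<comment> \<open>\<open>v\<close> and its at most three neighbours cannot exhaust more than four
    points, so a non-neighbour exists.\<close>
  have "card (insert v ?A) < card J"
    using le3 fin assms(2) \<open>v \<notin> ?A\<close> by (simp add: card_insert_if)
  then obtain x where "x \<in> J" "x \<notin> insert v ?A"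
    using fin by (meson card_mono finite_Int finite_insert leD subsetI)
  then have "card ?A \<le> 2"
    using nb(2)[of x] unfolding minus by auto
  with ge show ?thesis
    by simp
qed

section \<open>Parity of faces\<close>

text \<open>For pure \<open>v\<close>, these mixed points are the unit faces of the diagonal lattice
  that meet at \<open>v\<close>.\<close>

definition faces :: "int \<times> int \<Rightarrow> (int \<times> int) set" where
  "faces v = {(fst v + 1, snd v), (fst v, snd v + 1), (fst v - 1, snd v), (fst v, snd v - 1)}"

text \<open>Combinatorial form of the curve: \<open>degree\<close> counts the lattice edges at a
  vertex. As a sum of indicators it is settled by case splits on membership.\<close>

locale pure_cycle =
  fixes J :: "(int \<times> int) set"
  assumes fin: "finite J" and nonempty: "J \<noteq> {}"
    and conn: "connectedin khalimsky_plane J"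
    and pure: "v \<in> J \<Longrightarrow> pure_point v"
    and degree: "(x, y) \<in> J \<Longrightarrow>
      of_bool ((x + 1, y + 1) \<in> J) + of_bool ((x - 1, y + 1) \<in> J) +
      of_bool ((x - 1, y - 1) \<in> J) + of_bool ((x + 1, y - 1) \<in> J) = (2 :: nat)"
begin

text \<open>Only meaningful at mixed points: the ray in direction \<open>(1, 1)\<close> meets the edges of \<open>J\<close>
  transversally, between lattice points.\<close>

definition par :: "int \<times> int \<Rightarrow> bool" where
  "par p = odd (card {k :: nat. (fst p + int k, snd p + int k + 1) \<in> J \<and>
                               (fst p + int k + 1, snd p + int k) \<in> J})"

lemma fst_bound: obtains M where "\<And>x y. (x, y) \<in> J \<Longrightarrow> x < M"
proof
  fix x y
  assume "(x, y) \<in> J"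
  then have "x \<le> Max (fst ` J)"
    using fin by (force intro: Max_ge)
  then show "x < Max (fst ` J) + 1"
    by simp
qed

text \<open>Moving the start one step along its own ray drops the crossing with index 0 and shifts
  the others, so only that first edge can change the parity.\<close>

lemma par_NE: "par (x + 1, y + 1) = par (x, y) \<longleftrightarrow> \<not> ((x, y + 1) \<in> J \<and> (x + 1, y) \<in> J)"
proof -
  define K where "K = (\<lambda>x y. {k :: nat. (x + int k, y + int k + 1) \<in> J \<and> (x + int k + 1, y + int k) \<in> J})"
  \<comment> \<open>\<open>card\<close> is 0 on infinite sets, so comparing the counts requires
    finiteness; the bound on first coordinates of \<open>J\<close> bounds the ray index.\<close>
  have finK: "finite (K x y)" for x y
  proof -
    obtain M where M: "\<And>x y. (x, y) \<in> J \<Longrightarrow> x < M"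
      using fst_bound by blast
    have "K x y \<subseteq> {..nat (M - x)}"
    proof
      fix k
      assume "k \<in> K x y"
      then have "x + int k < M"
        unfolding K_def using M by blast
      then show "k \<in> {..nat (M - x)}"
        by simp
    qed
    then show ?thesis
      using finite_subset by blast
  qed
  have "k \<in> K x y \<longleftrightarrow> k = 0 \<and> (x, y + 1) \<in> J \<and> (x + 1, y) \<in> J \<or> k \<in> Suc ` K (x + 1) (y + 1)" for k
    by (cases k) (auto simp: K_def algebra_simps)
  then have "K x y = (if (x, y + 1) \<in> J \<and> (x + 1, y) \<in> J then {0} else {}) \<union> Suc ` K (x + 1) (y + 1)"
    by auto
  then have "card (K x y) =
      of_bool ((x, y + 1) \<in> J \<and> (x + 1, y) \<in> J) + card (K (x + 1) (y + 1))"
    using finK by (auto simp: card_insert_if card_image)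
  then show ?thesis
    unfolding par_def fst_conv snd_conv K_def by auto
qed

text \<open>Backwards induction along the two parallel rays: at each step the claim for the next pair of
  faces is corrected by the even degree of the vertex between the rays.\<close>

lemma par_SE: "par (x + 1, y - 1) = par (x, y) \<longleftrightarrow> \<not> ((x, y - 1) \<in> J \<and> (x + 1, y) \<in> J)"
proof -
  obtain M where M: "\<And>x y. (x, y) \<in> J \<Longrightarrow> x < M"
    using fst_bound by blast
  have "M - x \<le> int n \<Longrightarrow> ?thesis" for n
  proof (induction n arbitrary: x y)
    case 0
    \<comment> \<open>Here \<open>M \<le> x\<close>, so all of \<open>J\<close> lies to the left and
      neither ray meets it.\<close>
    have "\<not> par (x + d, y')" if "d \<ge> 0" for d y'
    proof -
      have "(x + d + int k, z) \<notin> J" for k z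
        using M[of "x + d + int k" z] 0 that by auto
      then show ?thesis
        by (simp add: par_def)
    qed
    from this[of 0] this[of 1] show ?case
      using 0 M[of x] M[of "x + 1"] by auto
  next
    case (Suc n)
    have IH: "par (x + 1 + 1, y + 1 - 1) = par (x + 1, y + 1) \<longleftrightarrow>
        \<not> ((x + 1, y + 1 - 1) \<in> J \<and> (x + 1 + 1, y + 1) \<in> J)"
      using Suc.IH[of "x + 1" "y + 1"] Suc.prems by simp
    \<comment> \<open>These facts account for three of the four edges at \<open>(x + 1, y)\<close>.
      The number of edges there being even, the fourth decides whether the two parities
      differ.\<close>
    show ?case
      using IH par_NE[of x y] par_NE[of "x + 1" "y - 1"] degree[of "x + 1" y]
      by (cases "(x + 1, y) \<in> J"; cases "(x, y + 1) \<in> J"; cases "(x, y - 1) \<in> J";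
          cases "(x + 2, y + 1) \<in> J"; cases "(x + 2, y - 1) \<in> J") (auto simp: algebra_simps)
  qed
  from this[of "nat (M - x)"] show ?thesis
    by simp
qed

text \<open>Going once round a vertex, each pair of consecutive faces is separated by one diagonal
  edge.\<close>

lemma par_faces:
  "par (x + 1, y) = par (x, y + 1) \<longleftrightarrow> \<not> ((x, y) \<in> J \<and> (x + 1, y + 1) \<in> J)"
  "par (x, y + 1) = par (x - 1, y) \<longleftrightarrow> \<not> ((x, y) \<in> J \<and> (x - 1, y + 1) \<in> J)"
  "par (x - 1, y) = par (x, y - 1) \<longleftrightarrow> \<not> ((x, y) \<in> J \<and> (x - 1, y - 1) \<in> J)"
  "par (x, y - 1) = par (x + 1, y) \<longleftrightarrow> \<not> ((x, y) \<in> J \<and> (x + 1, y - 1) \<in> J)"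
  using par_SE[of x "y + 1"] par_NE[of "x - 1" y] par_SE[of "x - 1" y] par_NE[of x "y - 1"]
  by auto

section \<open>Components of the complement\<close>

text \<open>Both points are forced off \<open>J\<close>, since connected sets of the subspace lie in
  the complement; reflexivity holds exactly there.\<close>

abbreviation linked :: "int \<times> int \<Rightarrow> int \<times> int \<Rightarrow> bool" where
  "linked \<equiv> connected_component_of (subtopology khalimsky_plane (UNIV - J))"

lemma linked_sym: "linked p q \<Longrightarrow> linked q p"
  by (simp add: connected_component_of_sym)

lemma linked_trans: "linked p q \<Longrightarrow> linked q r \<Longrightarrow> linked p r"
  by (rule connected_component_of_trans)

lemma linked_pair: "connectedin khalimsky_plane {p, q} \<Longrightarrow> p \<notin> J \<Longrightarrow> q \<notin> J \<Longrightarrow> linked p q"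
  unfolding connected_component_of_def by (rule exI[of _ "{p, q}"]) (simp add: connectedin_subtopology)

lemma mixed_notin: "pure_point (x, y) \<Longrightarrow> \<bar>x' - x\<bar> + \<bar>y' - y\<bar> = 1 \<Longrightarrow> (x', y') \<notin> J"
proof -
  assume "pure_point (x, y)" "\<bar>x' - x\<bar> + \<bar>y' - y\<bar> = 1"
  then have "\<not> pure_point (x', y')"
    unfolding pure_point_def fst_conv snd_conv by presburger
  then show ?thesis
    using pure by blast
qed

text \<open>At a pure point off \<open>J\<close> all four surrounding faces have the same parity.\<close>

definition side :: "int \<times> int \<Rightarrow> bool" where
  "side p = (if pure_point p then par (fst p + 1, snd p) else par p)"

lemma par_face_off_curve:
  assumes "v \<notin> J" "pure_point v" "m \<in> faces v"
  shows "par m = side v"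
proof -
  obtain x y where v: "v = (x, y)"
    by fastforce
  have "par (x + 1, y) = par (x, y + 1)" "par (x, y + 1) = par (x - 1, y)"
    "par (x - 1, y) = par (x, y - 1)"
    using par_faces[of x y] assms(1) unfolding v by blast+
  then show ?thesis
    using assms(2,3) by (auto simp: side_def faces_def v)
qed

text \<open>An orthogonal neighbour of a pure point is itself a face around it; a diagonal one
  shares a face with it, through which \<open>side\<close> can be compared.\<close>

lemma adjacent_pure_cases:
  assumes "connectedin khalimsky_plane {p, q}" "pure_point p" "p \<noteq> q"
  obtains "\<not> pure_point q" "q \<in> faces p"
  | m where "pure_point q" "m \<in> faces p" "m \<in> faces q"
proof -
  obtain x y x' y' where pq: "p = (x, y)" "q = (x', y')"
    by fastforce
  have pure: "pure_point q \<longleftrightarrow> even (x' + y')" "even (x + y)"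
    using assms(1,2) unfolding pq connectedin_khalimsky_plane_pair_iff pure_point_def fst_conv snd_conv
    by presburger+
  have "q \<in> faces p \<or> q \<in> {(x + 1, y + 1), (x - 1, y + 1), (x - 1, y - 1), (x + 1, y - 1)}"
  proof -
    have "x' = x - 1 \<or> x' = x \<or> x' = x + 1" "y' = y - 1 \<or> y' = y \<or> y' = y + 1"
      using assms(1) unfolding pq connectedin_khalimsky_plane_pair_iff by linarith+
    then show ?thesis
      using assms(3) unfolding pq by (elim disjE) (simp_all add: faces_def)
  qed
  then consider "q \<in> faces p" | "q = (x + 1, y + 1)" | "q = (x - 1, y + 1)"
    | "q = (x - 1, y - 1)" | "q = (x + 1, y - 1)"
    by blast
  then show ?thesis
  proof cases
    case 1
    then have "\<bar>x - x'\<bar> + \<bar>y - y'\<bar> = 1"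
      by (auto simp: faces_def pq)
    then have "\<not> pure_point q"
      using pure by presburger
    with 1 show ?thesis
      using that(1) by blast
  next
    case 2
    then show ?thesis
      using pure by (intro that(2)[of "(x + 1, y)"]) (auto simp: faces_def pq)
  next
    case 3
    then show ?thesis
      using pure by (intro that(2)[of "(x - 1, y)"]) (auto simp: faces_def pq)
  next
    case 4
    then show ?thesis
      using pure by (intro that(2)[of "(x - 1, y)"]) (auto simp: faces_def pq)
  next
    case 5
    then show ?thesis
      using pure by (intro that(2)[of "(x + 1, y)"]) (auto simp: faces_def pq)
  qed
qed

lemma side_adjacent_pure:
  assumes "connectedin khalimsky_plane {p, q}" "p \<notin> J" "q \<notin> J" "pure_point p"
  shows "side q = side p"
proof (cases "p = q")
  case False
  from assms(1,4) this show ?thesis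
  proof (cases rule: adjacent_pure_cases)
    case 1
    then show ?thesis
      using par_face_off_curve[OF assms(2,4)] by (simp add: side_def)
  next
    case (2 m)
    then show ?thesis
      using par_face_off_curve assms(2-4) by metis
  qed
qed simp

lemma side_adjacent:
  assumes "connectedin khalimsky_plane {p, q}" "p \<notin> J" "q \<notin> J"
  shows "side q = side p"
proof -
  obtain x y x' y' where [simp]: "p = (x, y)" "q = (x', y')"
    by fastforce
  \<comment> \<open>Distinct mixed points are never adjacent: an orthogonal step leads from mixed to
    pure, and diagonal adjacency requires pure points.\<close>
  have "p = q \<or> pure_point p \<or> pure_point q"
    using assms(1) unfolding \<open>p = _\<close> \<open>q = _\<close> connectedin_khalimsky_plane_pair_iff pure_point_def fst_conv snd_conv
      prod.inject by presburger
  then show ?thesis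
    using side_adjacent_pure[of p q] side_adjacent_pure[of q p] assms
    by (auto simp: insert_commute)
qed

text \<open>This invariance keeps faces of opposite parity in different components, so there are at
  least two.\<close>

lemma linked_imp_side_eq: "linked p q \<Longrightarrow> side q = side p"
proof -
  assume "linked p q"
  then obtain S where S: "connectedin khalimsky_plane S" "S \<subseteq> UNIV - J" "p \<in> S" "q \<in> S"
    by (auto simp: connected_component_of_def connectedin_subtopology)
  show ?thesis
    by (rule khalimsky_plane.connectedin_closed_under_adjacency[OF S(1,3)])
      (use S side_adjacent in \<open>auto, blast+\<close>)
qed

section \<open>Linking the faces along the curve\<close>

lemma faces_notin:
  assumes "v \<in> J" "m \<in> faces v"
  shows "m \<notin> J"
  using mixed_notin[of "fst v" "snd v" "fst m" "snd m"] pure[OF assms(1)] assms(2)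
  by (auto simp: faces_def)

lemma side_faces: "v \<in> J \<Longrightarrow> m \<in> faces v \<Longrightarrow> side m = par m"
  using pure[of v] by (auto simp: side_def faces_def pure_point_def)

text \<open>Consecutive faces of equal parity have no edge of \<open>J\<close> between them, so the
  diagonal point separating them is off \<open>J\<close> and adjacent to both.\<close>

lemma linked_faces_same_parity:
  assumes "v \<in> J" "m \<in> faces v" "m' \<in> faces v" "par m = par m'"
  shows "linked m m'"
proof -
  obtain x y where v: "v = (x, y)"
    by fastforce
  let ?E = "(x + 1, y)" and ?N = "(x, y + 1)" and ?W = "(x - 1, y)" and ?S = "(x, y - 1)"
  have nJ: "?E \<notin> J" "?N \<notin> J" "?W \<notin> J" "?S \<notin> J"
    using faces_notin[OF assms(1)] by (auto simp: faces_def v)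
  have via: "linked m m'" if "w \<notin> J" "connectedin khalimsky_plane {m, w}"
    "connectedin khalimsky_plane {w, m'}" "m \<notin> J" "m' \<notin> J" for w m m'
    using that linked_pair linked_trans by blast
  have "(x + 1, y + 1) \<notin> J \<Longrightarrow> linked ?E ?N" "(x - 1, y + 1) \<notin> J \<Longrightarrow> linked ?N ?W"
    "(x - 1, y - 1) \<notin> J \<Longrightarrow> linked ?W ?S" "(x + 1, y - 1) \<notin> J \<Longrightarrow> linked ?S ?E"
    by (erule via; use nJ in \<open>simp add: connectedin_khalimsky_plane_pair_iff\<close>)+
  then have adj: "par ?E = par ?N \<Longrightarrow> linked ?E ?N" "par ?N = par ?W \<Longrightarrow> linked ?N ?W"
    "par ?W = par ?S \<Longrightarrow> linked ?W ?S" "par ?S = par ?E \<Longrightarrow> linked ?S ?E"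
    using par_faces[of x y] assms(1) unfolding v by blast+
  \<comment> \<open>Alternation all the way round would need four edges at \<open>v\<close>. Hence
    opposite faces of equal parity have a face of that parity between them, which links
    them.\<close>
  have "\<not> (par ?E \<noteq> par ?N \<and> par ?N \<noteq> par ?W \<and> par ?W \<noteq> par ?S \<and> par ?S \<noteq> par ?E)"
    using degree[of x y] par_faces[of x y] assms(1) unfolding v by (auto simp: of_bool_def split: if_splits)
  then have "par ?E = par ?W \<Longrightarrow> linked ?E ?W" "par ?N = par ?S \<Longrightarrow> linked ?N ?S"
    using adj linked_sym linked_trans by metis+
  moreover have "linked ?E ?E" "linked ?N ?N" "linked ?W ?W" "linked ?S ?S"
    using nJ by (auto simp: connected_component_of_refl)
  moreover have "m \<in> {?E, ?N, ?W, ?S}" "m' \<in> {?E, ?N, ?W, ?S}"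
    using assms(2,3) by (auto simp: faces_def v)
  ultimately show ?thesis
    using adj linked_sym assms(4) by (elim insertE emptyE; metis)
qed

text \<open>The two faces beside an edge of \<open>J\<close> belong to both endpoints and have
  opposite parities, so either value of \<open>b\<close> occurs.\<close>

lemma edge_faces:
  assumes "v \<in> J" "w \<in> J" "v \<noteq> w" "connectedin khalimsky_plane {v, w}"
  shows "\<exists>m \<in> faces v \<inter> faces w. par m = b"
proof -
  obtain x y x' y' where [simp]: "v = (x, y)" "w = (x', y')"
    by fastforce
  have "\<not> (\<bar>x' - x\<bar> + \<bar>y' - y\<bar> = 1)"
    using mixed_notin[of x y x' y'] pure assms(1,2) by auto
  then have "(x', y') \<in> {(x + 1, y + 1), (x - 1, y + 1), (x - 1, y - 1), (x + 1, y - 1)}"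
    using assms(3,4) unfolding \<open>v = _\<close> \<open>w = _\<close> connectedin_khalimsky_plane_pair_iff by auto
  then consider "w = (x + 1, y + 1)" | "w = (x - 1, y + 1)" | "w = (x - 1, y - 1)" | "w = (x + 1, y - 1)"
    by auto
  then obtain m m' where "{m, m'} \<subseteq> faces v \<inter> faces w" "par m \<noteq> par m'"
  proof cases
    case 1
    show ?thesis
      by (rule that[of "(x + 1, y)" "(x, y + 1)"]) (use 1 par_faces(1)[of x y] assms(1,2) in \<open>auto simp: faces_def\<close>)
  next
    case 2
    show ?thesis
      by (rule that[of "(x, y + 1)" "(x - 1, y)"]) (use 2 par_faces(2)[of x y] assms(1,2) in \<open>auto simp: faces_def\<close>)
  next
    case 3
    show ?thesis
      by (rule that[of "(x - 1, y)" "(x, y - 1)"]) (use 3 par_faces(3)[of x y] assms(1,2) in \<open>auto simp: faces_def\<close>)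
  next
    case 4
    show ?thesis
      by (rule that[of "(x, y - 1)" "(x + 1, y)"]) (use 4 par_faces(4)[of x y] assms(1,2) in \<open>auto simp: faces_def\<close>)
  qed
  then show ?thesis
    by (cases "par m = b") auto
qed

text \<open>Induction along the connected curve: beside each edge lies a face of the required parity
  common to both endpoints, and it carries the component across.\<close>

lemma linked_faces_of_curve:
  assumes "v \<in> J" "m \<in> faces v" "w \<in> J" "m' \<in> faces w" "par m = par m'"
  shows "linked m m'"
proof -
  have "\<forall>m'\<in>faces w. par m = par m' \<longrightarrow> linked m m'"
  proof (rule khalimsky_plane.connectedin_closed_under_adjacency[OF conn assms(1) _ _ assms(3)])
    show "\<forall>m'\<in>faces v. par m = par m' \<longrightarrow> linked m m'"
      using linked_faces_same_parity assms(1,2) by blast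
  next
    fix p q
    assume pq: "p \<in> J" "q \<in> J" "connectedin khalimsky_plane {p, q}"
      and IH: "\<forall>m'\<in>faces p. par m = par m' \<longrightarrow> linked m m'"
    show "\<forall>m'\<in>faces q. par m = par m' \<longrightarrow> linked m m'"
    proof (intro ballI impI)
      fix m'
      assume m': "m' \<in> faces q" "par m = par m'"
      show "linked m m'"
      proof (cases "p = q")
        case True
        then show ?thesis
          using IH m' by blast
      next
        case False
        then obtain e where "e \<in> faces p" "e \<in> faces q" "par e = par m"
          using edge_faces[OF pq(1,2) _ pq(3)] by blast
        then show ?thesis
          using IH m' linked_faces_same_parity[OF pq(2)] linked_trans by metis
      qed
    qed
  qed
  then show ?thesis
    using assms by blast
qed

text \<open>Equal parities all round would mean that no edge of \<open>J\<close> ends at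
  \<open>v\<close>, against degree two.\<close>

lemma faces_both_parities:
  assumes "v \<in> J"
  shows "\<exists>m\<in>faces v. par m = b"
proof -
  obtain x y where v: "v = (x, y)"
    by fastforce
  have "\<not> (par (x + 1, y) = par (x, y + 1) \<and> par (x, y + 1) = par (x - 1, y) \<and>
      par (x - 1, y) = par (x, y - 1))"
  proof
    assume "par (x + 1, y) = par (x, y + 1) \<and> par (x, y + 1) = par (x - 1, y) \<and>
      par (x - 1, y) = par (x, y - 1)"
    then have "(x + 1, y + 1) \<notin> J" "(x - 1, y + 1) \<notin> J" "(x - 1, y - 1) \<notin> J" "(x + 1, y - 1) \<notin> J"
      using par_faces[of x y] assms unfolding v by blast+
    then show False
      using degree[of x y] assms unfolding v by simp
  qed
  then show ?thesis
    by (cases b) (auto simp: faces_def v)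
qed

section \<open>Exactly two components\<close>

text \<open>Walk from a point of \<open>J\<close> to \<open>p\<close> by horizontal and vertical
  steps. A step leaving \<open>J\<close> enters a face around the point left; while the walk stays
  off \<open>J\<close>, consecutive points are linked.\<close>

lemma linked_to_face:
  assumes "p \<notin> J"
  shows "\<exists>v\<in>J. \<exists>m\<in>faces v. linked p m"
proof -
  define Q where "Q p \<longleftrightarrow> p \<in> J \<or> (\<exists>v\<in>J. \<exists>m\<in>faces v. linked p m)" for p
  have step: "Q (x', y')" if "Q (x, y)" and d: "\<bar>x - x'\<bar> + \<bar>y - y'\<bar> = 1" for x y x' y'
  proof (cases "(x', y') \<in> J")
    case False
    show ?thesis
    proof (cases "(x, y) \<in> J")
      case True
      have "(x', y') \<in> faces (x, y)"
        using d by (auto simp: faces_def)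
      moreover have "linked (x', y') (x', y')"
        using False by (simp add: connected_component_of_refl)
      ultimately show ?thesis
        using True by (auto simp: Q_def)
    next
      assume "(x, y) \<notin> J"
      then have "linked (x', y') (x, y)"
        using False d by (intro linked_pair) (auto simp: connectedin_khalimsky_plane_pair_iff)
      then show ?thesis
        using that(1) \<open>(x, y) \<notin> J\<close> linked_trans unfolding Q_def by blast
    qed
  qed (simp add: Q_def)
  obtain a b where "(a, b) \<in> J"
    using nonempty by fastforce
  then have "Q (a, b)"
    by (simp add: Q_def)
  \<comment> \<open>\<open>int_induct\<close> runs in both directions: first along the row of
    \<open>(a, b)\<close>, then along every column.\<close>
  then have row: "Q (x, b)" for x
    by (induction x rule: int_induct[where k = a]) (auto intro: step)
  have "Q (x, y)" for x y
    by (induction y rule: int_induct[where k = b]) (auto intro: step row)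
  then have "Q p"
    by (cases p) simp
  then show ?thesis
    using assms by (simp add: Q_def)
qed

theorem complement_components:
  shows "card (connected_components_of (subtopology khalimsky_plane (UNIV - J))) = 2"
    and "\<lbrakk>v \<in> J; C \<in> connected_components_of (subtopology khalimsky_plane (UNIV - J))\<rbrakk>
      \<Longrightarrow> adjacent_to v C"
proof -
  let ?C = "\<lambda>p. Collect (linked p)"
  have comps: "connected_components_of (subtopology khalimsky_plane (UNIV - J)) = ?C ` (UNIV - J)"
    by (simp add: connected_components_of_def)
  obtain u where u: "u \<in> J"
    using nonempty by blast
  \<comment> \<open>Two faces of opposite parity around one point of \<open>J\<close> represent the
    two components.\<close>
  obtain m0 m1 where m: "m0 \<in> faces u" "m1 \<in> faces u" "\<not> par m0" "par m1"
    using faces_both_parities[OF u, of False] faces_both_parities[OF u, of True] by auto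
  have eq: "?C p = ?C q" if "linked p q" for p q
    using that linked_sym linked_trans by blast
  have face: "?C f = (if par f then ?C m1 else ?C m0)" if "v \<in> J" "f \<in> faces v" for v f
    using linked_faces_of_curve[OF that u m(1)] linked_faces_of_curve[OF that u m(2)] m(3,4) eq
    by auto
  have all: "?C p \<in> {?C m0, ?C m1}" if "p \<notin> J" for p
    using linked_to_face[OF that] eq face by (metis insertCI)
  have "m0 \<notin> J" "m1 \<notin> J"
    using faces_notin[OF u] m by auto
  then have two: "?C ` (UNIV - J) = {?C m0, ?C m1}"
    using all by blast
  have "linked m0 m0"
    using \<open>m0 \<notin> J\<close> by (simp add: connected_component_of_refl)
  moreover have "\<not> linked m1 m0"
    using linked_imp_side_eq[of m1 m0] side_faces[OF u] m by auto
  ultimately have "?C m0 \<noteq> ?C m1"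
    by blast
  then show "card (connected_components_of (subtopology khalimsky_plane (UNIV - J))) = 2"
    unfolding comps two by simp
  assume v: "v \<in> J" and "C \<in> connected_components_of (subtopology khalimsky_plane (UNIV - J))"
  then have "C = ?C m0 \<or> C = ?C m1"
    unfolding comps two by blast
  \<comment> \<open>Each component is the one of all curve faces of some parity, and that parity
    also occurs around \<open>v\<close>.\<close>
  then obtain f where f: "f \<in> faces v" "C = ?C f"
    using face[OF v] faces_both_parities[OF v] by metis
  have "f \<in> C"
    using f faces_notin[OF v f(1)] by (simp add: connected_component_of_refl)
  moreover have "f \<in> adjacency_set v"
    using f(1) by (cases v) (auto simp: faces_def adjacency_set_def connectedin_khalimsky_plane_pair_iff)
  ultimately show "adjacent_to v C"
    unfolding adjacent_to_def by blast
qed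

end

section \<open>Jordan curves as lattice cycles\<close>

text \<open>Orthogonal neighbours of a pure point are mixed, hence off \<open>J\<close>; the two
  neighbours on the curve are therefore diagonal ones.\<close>

lemma khal_jordan_curve_pure_cycle:
  assumes "khal_jordan_curve J" "\<forall>x\<in>J. pure_point x" "card J > 4"
  shows "pure_cycle J"
proof
  show "finite J"
    using assms(3) by (intro card_ge_0_finite) simp
  show "J \<noteq> {}"
    using assms(3) by auto
  show "connectedin khalimsky_plane J"
    using assms(1) by (simp add: khal_jordan_curve_def)
  show "pure_point v" if "v \<in> J" for v
    using assms(2) that by blast
  fix x y
  assume xy: "(x, y) \<in> J"
  let ?D = "{(x + 1, y + 1), (x - 1, y + 1), (x - 1, y - 1), (x + 1, y - 1)}"
  have pxy: "pure_point (x, y)"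
    using assms(2) xy by blast
  have "J \<inter> adjacency_set (x, y) = ?D \<inter> J"
  proof (intro equalityI subsetI)
    fix q
    assume q: "q \<in> J \<inter> adjacency_set (x, y)"
    obtain x' y' where [simp]: "q = (x', y')"
      by fastforce
    have "pure_point (x', y')"
      using q assms(2) by auto
    then have "\<bar>x - x'\<bar> + \<bar>y - y'\<bar> \<noteq> 1"
      using pxy unfolding pure_point_def fst_conv snd_conv by presburger
    then show "q \<in> ?D \<inter> J"
      using q by (auto simp: adjacency_set_def connectedin_khalimsky_plane_pair_iff)
  next
    fix q
    assume "q \<in> ?D \<inter> J"
    then show "q \<in> J \<inter> adjacency_set (x, y)"
      using pxy by (auto simp: adjacency_set_def connectedin_khalimsky_plane_pair_iff)
  qed
  then have "card (?D \<inter> J) = 2"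
    using khal_jordan_curve_degree[OF assms(1,3) xy] by simp
  then show "of_bool ((x + 1, y + 1) \<in> J) + of_bool ((x - 1, y + 1) \<in> J) +
      of_bool ((x - 1, y - 1) \<in> J) + of_bool ((x + 1, y - 1) \<in> J) = (2 :: nat)"
    by (simp add: Int_insert_left split: if_splits)
qed

theorem theorem7p1:
  fixes J :: "(int \<times> int) set"
  assumes "khal_jordan_curve J"
    and "\<forall>x\<in>J. pure_point x"
    and "card J > 4"
  shows "card (connected_components_of (subtopology khalimsky_plane (UNIV - J))) = 2 \<and>
    (\<forall>x\<in>J. \<forall>C\<in>connected_components_of (subtopology khalimsky_plane (UNIV - J)).
       adjacent_to x C)"
  using pure_cycle.complement_components[OF khal_jordan_curve_pure_cycle[OF assms]] by blast

end
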